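(* Let $g:[0,\infty)\to(0,\infty)$ be a positive, (strictly) increasing and differentiable function, let $k>0$ be real and $q\in(0,1)$. Let $\lambda,\mu$ be positive real numbers. Then for all real $x,y$ with $0<x<y$, $$\frac{(g(0))^{\lambda}\,e^{\frac{\lambda\gamma}{k}(g(0)-g(x))}\,\Gamma_k(g(0))^\lambda}{(g(x))^{\lambda}\,k^{\frac{\lambda}{k}(g(0)-g(x))}\,(1-q)^{\frac{\mu}{k}(g(0)-g(x))}\,\Gamma_{(q,k)}(g(0))^\mu}\;<\;\frac{\Gamma_k(g(x))^\lambda}{\Gamma_{(q,k)}(g(x))^\mu}\;<\;\frac{(g(y))^{\lambda}\,e^{\frac{\lambda\gamma}{k}(g(y)-g(x))}\,\Gamma_k(g(y))^\lambda}{(g(x))^{\lambda}\,k^{\frac{\lambda}{k}(g(y)-g(x))}\,(1-q)^{\frac{\mu}{k}(g(y)-g(x))}\,\Gamma_{(q,k)}(g(y))^\mu}.$$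
   Context: $\gamma=\lim_{n\to\infty}\left(\sum_{j=1}^{n}\frac1j-\ln n\right)$ is the Euler–Mascheroni constant. For $k>0$ and $t>0$, the $k$-Gamma function is $$\Gamma_k(t)=\int_0^\infty e^{-\frac{x^k}{k}}x^{t-1}\,dx.$$ For $q\in(0,1)$, $k>0$ and $t>0$, the $(q,k)$-Gamma function (Díaz–Teruel) is $$\Gamma_{(q,k)}(t)=\frac{(1-q^k)_{q,k}^{\frac{t}{k}-1}}{(1-q)^{\frac{t}{k}-1}},$$ where $(1+x)_{q,k}^{\infty}=\prod_{j=0}^{\infty}(1+q^{jk}x)$ and $(1+x)_{q,k}^{s}=\frac{(1+x)_{q,k}^{\infty}}{(1+q^{ks}x)_{q,k}^{\infty}}$ for real $s$; explicitly, $$(1-q^k)_{q,k}^{\frac{t}{k}-1}=\prod_{j=0}^{\infty}\frac{1-q^{(j+1)k}}{1-q^{t+jk}}.$$ *)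

theory Defs
  imports "HOL-Analysis.Analysis"
begin

text \<open>
  The integrand is nonnegative, so the Henstock--Kurzweil integral over \<open>[0, \<infinity>)\<close>
  coincides with the (improper or Lebesgue) integral; its value at the end point \<open>x = 0\<close>,
  where \<open>powr\<close> returns \<open>0\<close>, is immaterial.
\<close>
definition Gamma_k :: "real \<Rightarrow> real \<Rightarrow> real" where
  "Gamma_k k t = integral {0..} (\<lambda>x. exp (- (x powr k) / k) * x powr (t - 1))"

text \<open>\<open>(1 + x)\<close> to the power infinity, with subscript \<open>q, k\<close>.\<close>
definition qk_power_inf :: "real \<Rightarrow> real \<Rightarrow> real \<Rightarrow> real" where
  "qk_power_inf q k x = (\<Prod>j. 1 + q powr (real j * k) * x)"

text \<open>
  \<open>(1 + x)\<close> to the power \<open>s\<close>, with subscript \<open>q, k\<close>; the argument is \<open>x\<close>, not \<open>1 + x\<close>.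
\<close>
definition qk_power :: "real \<Rightarrow> real \<Rightarrow> real \<Rightarrow> real \<Rightarrow> real" where
  "qk_power q k x s = qk_power_inf q k x / qk_power_inf q k (q powr (k * s) * x)"

definition Gamma_qk :: "real \<Rightarrow> real \<Rightarrow> real \<Rightarrow> real" where
  "Gamma_qk q k t = qk_power q k (- (q powr k)) (t / k - 1) / (1 - q) powr (t / k - 1)"

end

theory Submission
  imports Defs
begin

text \<open>
  Both inequalities say that a single function of \<open>t > 0\<close> is strictly increasing, evaluated at the
  pairs \<open>g 0 < g x\<close> and \<open>g x < g y\<close>. Collecting in each bound the factors that depend on the
  same point gives the function \<open>A t powr lam / B t powr mu\<close>, where

  \<open>A t = t * Gamma_k k t * exp (\<gamma> * t / k) / k powr (t / k)\<close> and
  \<open>B t = (1 - q) powr (t / k) * Gamma_qk q k t\<close>.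

  Substituting \<open>u = x powr k / k\<close> in the integral gives
  \<open>Gamma_k k t = k powr (t / k - 1) * Gamma (t / k)\<close>, so with \<open>s = t / k\<close> the factor \<open>A t\<close> is
  \<open>exp (\<gamma> * s) * Gamma (1 + s)\<close>. Its logarithmic derivative \<open>\<gamma> + Digamma (1 + s)\<close> is positive
  because \<open>Digamma 1 = - \<gamma>\<close> and \<open>Digamma\<close> increases; hence \<open>A\<close> is strictly increasing
  (\<open>strict_mono_normalized_Gamma_k\<close>).

  The powers of \<open>1 - q\<close> in \<open>B t\<close> cancel up to one factor, leaving a positive constant divided by
  \<open>\<Prod>j. 1 - q powr (j * k + t)\<close>. Every factor of that product increases with \<open>t\<close>, so \<open>B\<close> decreases
  (\<open>antimono_normalized_Gamma_qk\<close>).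
\<close>

section \<open>The k-Gamma function\<close>

text \<open>
  The substitution \<open>u = x powr k / k\<close> maps the open half line onto itself. Omitting the end point
  keeps it differentiable also for \<open>k < 1\<close>.
\<close>
lemma Gamma_k_eq_Gamma:
  fixes k t :: real
  assumes k: "k > 0" and t: "t > 0"
  shows "Gamma_k k t = k powr (t / k - 1) * Gamma (t / k)"
proof -
  define s where "s = t / k"
  have s: "s > 0" using k t by (simp add: s_def)
  define \<phi> where "\<phi> = (\<lambda>x::real. x powr k / k)"
  define \<phi>' where "\<phi>' = (\<lambda>x::real. x powr (k - 1))"
  define f where "f = (\<lambda>u::real. u powr (s - 1) / exp u)"
  have deriv: "(\<phi> has_field_derivative \<phi>' x) (at x within {0<..})" if "x \<in> {0<..}" for x
    unfolding \<phi>_def \<phi>'_def using that k by (auto intro!: derivative_eq_intros)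
  have inj: "inj_on \<phi> {0<..}"
    using k by (auto simp: \<phi>_def intro!: strict_mono_on_imp_inj_on strict_mono_onI divide_strict_right_mono
        powr_less_mono2)
  have image: "\<phi> ` {0<..} = {0<..}"
  proof (intro equalityI subsetI)
    fix u :: real assume u: "u \<in> {0<..}"
    have "\<phi> ((k * u) powr (1 / k)) = u"
      using u k by (simp add: \<phi>_def powr_powr)
    moreover have "(k * u) powr (1 / k) \<in> {0<..}" using u k by simp
    ultimately show "u \<in> \<phi> ` {0<..}" by (metis imageI)
  qed (use k in \<open>auto simp: \<phi>_def\<close>)
  \<comment> \<open>Both integrands vanish at \<open>0\<close>, since \<open>0 powr a = 0\<close> for every \<open>a\<close>.\<close>
  have spike: "(h has_integral i) {0..} \<longleftrightarrow> (h has_integral i) {0<..}"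
    if "h 0 = 0" for h :: "real \<Rightarrow> real" and i
  proof (rule has_integral_spike_set_eq)
    have *: "{x \<in> {0..} - {0<..}. h x \<noteq> 0} = {}"
      using that by (auto simp: less_eq_real_def)
    show "negligible {x \<in> {0..} - {0<..}. h x \<noteq> 0}" by (subst *) simp
    have **: "{x \<in> {0<..} - {0..}. h x \<noteq> 0} = {}" by auto
    show "negligible {x \<in> {0<..} - {0..}. h x \<noteq> 0}" by (subst **) simp
  qed
  have Gamma_int: "(f has_integral Gamma s) {0<..}"
    using Gamma_integral_real[OF s] by (simp add: f_def spike)
  have "f absolutely_integrable_on {0<..}"
    using Gamma_int by (intro nonnegative_absolutely_integrable_1) (auto simp: f_def integrable_on_def)
  then have "f absolutely_integrable_on \<phi> ` {0<..} \<and> integral (\<phi> ` {0<..}) f = Gamma s"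
    using Gamma_int image by (simp add: integral_unique)
  then have subst_int: "(\<lambda>x. \<bar>\<phi>' x\<bar> * f (\<phi> x)) absolutely_integrable_on {0<..}
      \<and> integral {0<..} (\<lambda>x. \<bar>\<phi>' x\<bar> * f (\<phi> x)) = Gamma s"
    using deriv inj by (subst has_absolute_integral_change_of_variables_1') auto
  have integrand: "\<bar>\<phi>' x\<bar> * f (\<phi> x)
      = k powr (1 - s) * (exp (- (x powr k) / k) * x powr (t - 1))" if "x \<in> {0<..}" for x
  proof -
    have x: "x > 0" using that by simp
    have "(x powr k / k) powr (s - 1) = x powr (t - k) * k powr (1 - s)"
    proof -
      have "k * (s - 1) = t - k" using k by (simp add: s_def field_simps)
      moreover have "k powr (1 - s) = 1 / k powr (s - 1)"
        by (simp flip: powr_minus_divide)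
      ultimately show ?thesis using x k by (simp add: powr_divide powr_powr)
    qed
    then have "\<bar>\<phi>' x\<bar> * f (\<phi> x)
        = k powr (1 - s) * (exp (- (x powr k) / k) * (x powr (k - 1) * x powr (t - k)))"
      by (simp add: \<phi>'_def \<phi>_def f_def exp_minus field_simps)
    then show ?thesis by (simp flip: powr_add)
  qed
  have "integral {0<..} (\<lambda>x. k powr (1 - s) * (exp (- (x powr k) / k) * x powr (t - 1))) = Gamma s"
    using subst_int integrand by (metis (no_types, lifting) integral_cong)
  then have "k powr (1 - s) * integral {0<..} (\<lambda>x. exp (- (x powr k) / k) * x powr (t - 1)) = Gamma s"
    by simp
  moreover have "integral {0..} (\<lambda>x. exp (- (x powr k) / k) * x powr (t - 1))
      = integral {0<..} (\<lambda>x. exp (- (x powr k) / k) * x powr (t - 1))"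
    by (simp add: integral_def integrable_on_def spike)
  ultimately have "k powr (1 - s) * Gamma_k k t = Gamma s"
    by (simp add: Gamma_k_def)
  moreover have "k powr (s - 1) * k powr (1 - s) = 1"
    using k by (simp flip: powr_add)
  ultimately show ?thesis
    unfolding s_def[symmetric] by (metis mult.assoc mult_1)
qed

lemma Gamma_k_pos: "k > 0 \<Longrightarrow> t > 0 \<Longrightarrow> Gamma_k k t > 0"
  by (simp add: Gamma_k_eq_Gamma Gamma_real_pos)

text \<open>The derivative of the logarithm is \<open>\<gamma> + Digamma (1 + s)\<close>, which vanishes at \<open>s = 0\<close>.\<close>
lemma strict_mono_exp_euler_mascheroni_Gamma:
  fixes s u :: real
  assumes "0 < s" and "s < u"
  shows "exp (euler_mascheroni * s) * Gamma (1 + s) < exp (euler_mascheroni * u) * Gamma (1 + u)"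
proof -
  have "euler_mascheroni * s + ln_Gamma (1 + s) < euler_mascheroni * u + ln_Gamma (1 + u)"
  proof (rule DERIV_pos_imp_increasing[OF assms(2)])
    fix v assume "s \<le> v" "v \<le> u"
    then have v: "v > 0" using assms by simp
    have "((\<lambda>v. euler_mascheroni * v + ln_Gamma (1 + v)) has_real_derivative
        (euler_mascheroni + Digamma (1 + v))) (at v)"
      using v by (auto intro!: derivative_eq_intros)
    moreover have "Digamma 1 < Digamma (1 + v)"
      using v by (intro Digamma_real_strict_mono) auto
    ultimately show "\<exists>d. ((\<lambda>v. euler_mascheroni * v + ln_Gamma (1 + v)) has_real_derivative d) (at v)
        \<and> 0 < d"
      by (intro exI[of _ "euler_mascheroni + Digamma (1 + v)"]) simp
  qed
  then have "exp (euler_mascheroni * s + ln_Gamma (1 + s)) < exp (euler_mascheroni * u + ln_Gamma (1 + u))"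
    by simp
  then show ?thesis using assms by (simp add: exp_add Gamma_real_pos_exp)
qed

definition normalized_Gamma_k :: "real \<Rightarrow> real \<Rightarrow> real" where
  "normalized_Gamma_k k t = t * Gamma_k k t * exp (euler_mascheroni * t / k) / k powr (t / k)"

lemma normalized_Gamma_k_pos: "k > 0 \<Longrightarrow> t > 0 \<Longrightarrow> normalized_Gamma_k k t > 0"
  by (simp add: normalized_Gamma_k_def Gamma_k_pos)

lemma normalized_Gamma_k_eq:
  assumes "k > 0" and "t > 0"
  shows "normalized_Gamma_k k t = exp (euler_mascheroni * (t / k)) * Gamma (1 + t / k)"
proof -
  have "Gamma (1 + t / k) = t / k * Gamma (t / k)"
    using assms Gamma_plus1[of "t / k"]
    by (metis add.commute divide_pos_pos nonpos_Ints_nonpos not_less)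
  then show ?thesis
    using assms by (simp add: normalized_Gamma_k_def Gamma_k_eq_Gamma powr_diff)
qed

lemma strict_mono_normalized_Gamma_k:
  assumes "k > 0" and "0 < a" and "a < b"
  shows "normalized_Gamma_k k a < normalized_Gamma_k k b"
  using strict_mono_exp_euler_mascheroni_Gamma[of "a / k" "b / k"] assms
  by (simp add: normalized_Gamma_k_eq divide_strict_right_mono)

section \<open>The (q,k)-Gamma function\<close>

text \<open>The factors differ from \<open>1\<close> by a geometric sequence with ratio \<open>q powr k < 1\<close>.\<close>
lemma convergent_prod_qk_power_inf:
  fixes q k x :: real
  assumes "0 < q" and "q < 1" and "k > 0"
  shows "convergent_prod (\<lambda>j. 1 + q powr (real j * k) * x)"
proof -
  have "q powr k < 1"
    using assms by (simp add: powr01_less_one)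
  then have "summable (\<lambda>j. (q powr k) ^ j * \<bar>x\<bar>)"
    by (intro summable_mult2 summable_geometric) simp
  moreover have "(q powr k) ^ j = q powr (real j * k)" for j
    using assms by (simp add: powr_realpow[symmetric] powr_powr mult.commute)
  ultimately have "summable (\<lambda>j. norm (1 + q powr (real j * k) * x - 1))"
    by (simp add: abs_mult)
  then show ?thesis
    by (intro abs_convergent_prod_imp_convergent_prod summable_imp_abs_convergent_prod)
qed

lemma qk_power_inf_factor_pos:
  fixes q k x :: real
  assumes "0 < q" and "q < 1" and "k > 0" and "x > -1"
  shows "1 + q powr (real j * k) * x > 0"
proof -
  have "q powr (real j * k) \<le> 1" using assms by (intro powr_le1) auto
  moreover have "q powr (real j * k) * (-1) < q powr (real j * k) * x"
    using assms by (intro mult_strict_left_mono) auto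
  ultimately show ?thesis by linarith
qed

lemma qk_power_inf_pos:
  assumes "0 < q" and "q < 1" and "k > 0" and "x > -1"
  shows "qk_power_inf q k x > 0"
  unfolding qk_power_inf_def using assms
  by (intro less_0_prodinf convergent_prod_qk_power_inf qk_power_inf_factor_pos)

lemma qk_power_inf_mono:
  assumes "0 < q" and "q < 1" and "k > 0" and "x > -1" and "x \<le> y"
  shows "qk_power_inf q k x \<le> qk_power_inf q k y"
  unfolding qk_power_inf_def
proof (rule prodinf_le)
  show "(\<lambda>j. 1 + q powr (real j * k) * x) has_prod (\<Prod>j. 1 + q powr (real j * k) * x)"
    "(\<lambda>j. 1 + q powr (real j * k) * y) has_prod (\<Prod>j. 1 + q powr (real j * k) * y)"
    using assms by (auto intro!: convergent_prod_has_prod convergent_prod_qk_power_inf)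
  show "0 \<le> 1 + q powr (real j * k) * x \<and>
      1 + q powr (real j * k) * x \<le> 1 + q powr (real j * k) * y" for j
    using qk_power_inf_factor_pos[of q k x j] assms by (auto intro!: mult_left_mono)
qed

definition normalized_Gamma_qk :: "real \<Rightarrow> real \<Rightarrow> real \<Rightarrow> real" where
  "normalized_Gamma_qk q k t = (1 - q) powr (t / k) * Gamma_qk q k t"

lemma normalized_Gamma_qk_eq:
  assumes "0 < q" and "q < 1" and "k > 0"
  shows "normalized_Gamma_qk q k t
    = (1 - q) * qk_power_inf q k (- (q powr k)) / qk_power_inf q k (- (q powr t))"
proof -
  have "q powr (k * (t / k - 1)) * q powr k = q powr t"
    using assms by (simp add: right_diff_distrib flip: powr_add)
  then show ?thesis
    using assms by (simp add: normalized_Gamma_qk_def Gamma_qk_def qk_power_def powr_diff)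
qed

lemma normalized_Gamma_qk_pos:
  assumes "0 < q" and "q < 1" and "k > 0" and "t > 0"
  shows "normalized_Gamma_qk q k t > 0"
  using assms by (simp add: normalized_Gamma_qk_eq qk_power_inf_pos powr01_less_one)

lemma Gamma_qk_pos:
  assumes "0 < q" and "q < 1" and "k > 0" and "t > 0"
  shows "Gamma_qk q k t > 0"
  using normalized_Gamma_qk_pos[OF assms] assms
  by (simp add: normalized_Gamma_qk_def zero_less_mult_iff)

lemma antimono_normalized_Gamma_qk:
  assumes "0 < q" and "q < 1" and "k > 0" and "0 < a" and "a \<le> b"
  shows "normalized_Gamma_qk q k b \<le> normalized_Gamma_qk q k a"
proof -
  have "q powr b \<le> q powr a" using assms by (simp add: powr_mono')
  moreover have "q powr a < 1" "q powr k < 1" using assms by (simp_all add: powr01_less_one)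
  ultimately show ?thesis
    using assms unfolding normalized_Gamma_qk_eq[OF assms(1-3)]
    by (intro divide_left_mono qk_power_inf_mono mult_nonneg_nonneg mult_pos_pos
        less_imp_le[OF qk_power_inf_pos] qk_power_inf_pos) auto
qed

section \<open>The bounds for the ratio\<close>

definition normalized_ratio :: "real \<Rightarrow> real \<Rightarrow> real \<Rightarrow> real \<Rightarrow> real \<Rightarrow> real" where
  "normalized_ratio q k lam mu t = normalized_Gamma_k k t powr lam / normalized_Gamma_qk q k t powr mu"

lemma normalized_ratio_pos:
  assumes "0 < q" and "q < 1" and "k > 0" and "t > 0"
  shows "normalized_ratio q k lam mu t > 0"
  using normalized_Gamma_k_pos[OF assms(3,4)] normalized_Gamma_qk_pos[OF assms]
  by (simp add: normalized_ratio_def)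

lemma strict_mono_normalized_ratio:
  assumes "0 < q" and "q < 1" and "k > 0" and "lam > 0" and "mu \<ge> 0" and "0 < a" and "a < b"
  shows "normalized_ratio q k lam mu a < normalized_ratio q k lam mu b"
  unfolding normalized_ratio_def
proof (rule frac_less)
  show "normalized_Gamma_k k a powr lam < normalized_Gamma_k k b powr lam"
    using assms strict_mono_normalized_Gamma_k[of k a b] normalized_Gamma_k_pos[of k a]
    by (intro powr_less_mono2) auto
  show "normalized_Gamma_qk q k b powr mu \<le> normalized_Gamma_qk q k a powr mu"
    using assms antimono_normalized_Gamma_qk[of q k a b] normalized_Gamma_qk_pos[of q k b]
    by (intro powr_mono2) auto
  show "0 < normalized_Gamma_qk q k b powr mu"
    using assms normalized_Gamma_qk_pos[of q k b] by simp
qed simp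

lemma normalized_ratio_expand:
  assumes "0 < q" and "q < 1" and "k > 0" and "t > 0"
  shows "normalized_ratio q k lam mu t
    = t powr lam * Gamma_k k t powr lam * exp (lam * euler_mascheroni / k * t)
      / (k powr (lam / k * t) * (1 - q) powr (mu / k * t) * Gamma_qk q k t powr mu)"
proof -
  have "exp (euler_mascheroni * t / k) powr lam = exp (lam * euler_mascheroni / k * t)"
    by (simp add: powr_def mult.commute)
  moreover have "0 \<le> Gamma_k k t" "0 \<le> Gamma_qk q k t"
    using Gamma_k_pos[of k t] Gamma_qk_pos[of q k t] assms by auto
  ultimately show ?thesis
    using assms
    by (simp add: normalized_ratio_def normalized_Gamma_k_def normalized_Gamma_qk_def
        powr_mult powr_divide powr_powr mult_ac)
qed

text \<open>
  Every factor whose exponent contains \<open>a - c\<close> splits into one factor at \<open>a\<close> and one at \<open>c\<close>. With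
  \<open>c = g x\<close>, this turns either inequality into a comparison of a quotient of normalized ratios with \<open>1\<close>.
\<close>
lemma Gamma_ratio_bound_eq:
  assumes "0 < q" and "q < 1" and "k > 0" and "a > 0" and "c > 0"
  shows "(a powr lam * exp (lam * euler_mascheroni / k * (a - c)) * Gamma_k k a powr lam)
       / (c powr lam * k powr (lam / k * (a - c)) * (1 - q) powr (mu / k * (a - c))
            * Gamma_qk q k a powr mu)
    = normalized_ratio q k lam mu a / normalized_ratio q k lam mu c
      * (Gamma_k k c powr lam / Gamma_qk q k c powr mu)"
proof -
  have pos: "Gamma_k k a > 0" "Gamma_k k c > 0" "Gamma_qk q k a > 0" "Gamma_qk q k c > 0"
    using assms by (simp_all add: Gamma_k_pos Gamma_qk_pos)
  show ?thesis
    unfolding normalized_ratio_expand[OF assms(1-4)] normalized_ratio_expand[OF assms(1-3,5)]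
      right_diff_distrib exp_diff powr_diff
    using assms pos by (simp add: mult_ac)
qed

theorem theorem2p8:
  fixes g :: "real \<Rightarrow> real" and k q lam mu x y :: real
  assumes "\<And>u. u \<ge> 0 \<Longrightarrow> g u > 0"
    and "strict_mono_on {0..} g"
    and "g differentiable_on {0..}"
    and "k > 0" and "0 < q" and "q < 1"
    and "lam > 0" and "mu > 0"
    and "0 < x" and "x < y"
  shows
    "(g 0 powr lam * exp (lam * euler_mascheroni / k * (g 0 - g x)) * Gamma_k k (g 0) powr lam)
       / (g x powr lam * k powr (lam / k * (g 0 - g x)) * (1 - q) powr (mu / k * (g 0 - g x))
            * Gamma_qk q k (g 0) powr mu)
     < Gamma_k k (g x) powr lam / Gamma_qk q k (g x) powr mu
   \<and> Gamma_k k (g x) powr lam / Gamma_qk q k (g x) powr mu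
     < (g y powr lam * exp (lam * euler_mascheroni / k * (g y - g x)) * Gamma_k k (g y) powr lam)
       / (g x powr lam * k powr (lam / k * (g y - g x)) * (1 - q) powr (mu / k * (g y - g x))
            * Gamma_qk q k (g y) powr mu)"
proof -
  let ?H = "normalized_ratio q k lam mu" and ?R = "Gamma_k k (g x) powr lam / Gamma_qk q k (g x) powr mu"
  have g_pos: "g 0 > 0" "g x > 0" "g y > 0"
    using assms by auto
  have g_less: "g 0 < g x" "g x < g y"
    using assms(2,9,10) by (auto intro: strict_mono_onD)
  have R: "?R > 0"
    using assms(4-6) g_pos Gamma_k_pos[of k "g x"] Gamma_qk_pos[of q k "g x"] by simp
  have H: "?H (g 0) < ?H (g x)" "?H (g x) < ?H (g y)"
    using assms(4-8) g_pos g_less by (auto intro!: strict_mono_normalized_ratio)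
  have "?H (g x) > 0"
    using assms(4-6) g_pos by (simp add: normalized_ratio_pos)
  then have "?H (g 0) / ?H (g x) < 1" "1 < ?H (g y) / ?H (g x)"
    using H by simp_all
  then have "?H (g 0) / ?H (g x) * ?R < ?R" "?R < ?H (g y) / ?H (g x) * ?R"
    using mult_strict_right_mono[OF _ R] by fastforce+
  then show ?thesis
    by (simp only: Gamma_ratio_bound_eq[OF assms(5,6,4) g_pos(1,2)]
        Gamma_ratio_bound_eq[OF assms(5,6,4) g_pos(3,2)] simp_thms)
qed

end
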